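(* Let $F=\langle X,D,C\rangle$ be a satisfiable CSP instance and let $g\subseteq\mathcal{S}(F)$ be the set of solutions in a connected component of the solutions network of $F$. Let $s_F$ be a weighting seed and $d_F$ a dispatcher, and let the weights $w_F$ be built from $s_F$ and $d_F$ by $$w_F(\sigma,x)=\omega_F(x,\sigma(x),A_F(\sigma,x)),$$ $$\omega_F(x,a,\Delta)=\begin{cases}s_F(x,a)+\dfrac{d_F(x,a)}{\sum_{b\in\Delta}d_F(x,b)}\displaystyle\sum_{b\in D\setminus\Delta}s_F(x,b)&\text{if }a\in\Delta,\\0&\text{otherwise.}\end{cases}$$ If $s_F$ is unitary, then $W_F(g)\ge 1$.
   Context: A CSP instance is a triple $F=\langle X,D,C\rangle$ with $X$ a finite set of variables, $D$ a finite domain of values, and $C$ a set of constraints; a constraint is a pair $\langle (x_1,\dots,x_k),R\rangle$ with $(x_1,\dots,x_k)\in X^k$, $R\subseteq D^k$, for some integer $k$. A valuation is a map $v\in D^X$; it satisfies the constraint iff $(v(x_1),\dots,v(x_k))\in R$. A solution of $F$ is a valuation satisfying all constraints; $\mathcal{S}(F)$ is the set of solutions; $F$ is satisfiable iff $\mathcal{S}(F)\neq\emptyset$. Two solutions are $x$-adjacent if they agree on all variables other than $x$ (each solution is $x$-adjacent to itself). The solutions network is the undirected graph on $\mathcal{S}(F)$ in which two distinct solutions are joined iff they are $x$-adjacent for some $x\in X$. $N_F(\sigma,x)$ is the set of solutions $x$-adjacent to $\sigma$, and $A_F(\sigma,x)=\{\tau(x):\tau\in N_F(\sigma,x)\}$.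 A weighting seed is a function $s_F:X\times D\to\mathbb{R}_{\ge0}$; it is unitary iff $\sum_{a\in D}s_F(x,a)=1$ for all $x\in X$. A dispatcher is a function $d_F:X\times D\to\mathbb{R}_{>0}$. The weight of a solution is $W_F(\sigma)=\prod_{x\in X}w_F(\sigma,x)$, and $W_F(g)=\sum_{\sigma\in g}W_F(\sigma)$. *)

theory Defs
  imports Complex_Main "HOL-Library.FuncSet"
begin

type_synonym ('x, 'a) constr = "'x list \<times> 'a list set"

record ('x, 'a) csp =
  variables :: "'x set"
  domain :: "'a set"
  constraints :: "('x, 'a) constr set"

text \<open>A tuple in \<open>X\<^sup>k\<close> or \<open>D\<^sup>k\<close> is a list of length \<open>k\<close>; different constraints may have
  different arities, and the set of constraints is not required to be finite.\<close>

definition csp_instance :: "('x, 'a) csp \<Rightarrow> bool" where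
  "csp_instance F \<longleftrightarrow>
     finite (variables F) \<and> finite (domain F) \<and>
     (\<forall>(xs, R) \<in> constraints F.
        set xs \<subseteq> variables F \<and>
        (\<forall>as \<in> R. length as = length xs \<and> set as \<subseteq> domain F))"

text \<open>Extensional functions make \<open>D\<^sup>X\<close> literally the set of maps from \<open>X\<close> to \<open>D\<close>: distinct
  valuations differ at some variable of \<open>X\<close>.\<close>

definition valuations :: "('x, 'a) csp \<Rightarrow> ('x \<Rightarrow> 'a) set" where
  "valuations F = variables F \<rightarrow>\<^sub>E domain F"

definition satisfies :: "('x \<Rightarrow> 'a) \<Rightarrow> ('x, 'a) constr \<Rightarrow> bool" where
  "satisfies v c \<longleftrightarrow> map v (fst c) \<in> snd c"

definition solutions :: "('x, 'a) csp \<Rightarrow> ('x \<Rightarrow> 'a) set" where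
  "solutions F = {v \<in> valuations F. \<forall>c \<in> constraints F. satisfies v c}"

definition satisfiable :: "('x, 'a) csp \<Rightarrow> bool" where
  "satisfiable F \<longleftrightarrow> solutions F \<noteq> {}"

definition adjacent :: "('x, 'a) csp \<Rightarrow> 'x \<Rightarrow> ('x \<Rightarrow> 'a) \<Rightarrow> ('x \<Rightarrow> 'a) \<Rightarrow> bool" where
  "adjacent F x \<sigma> \<tau> \<longleftrightarrow> (\<forall>y \<in> variables F - {x}. \<sigma> y = \<tau> y)"

text \<open>The undirected solutions network on the vertex set \<^term>\<open>solutions F\<close>, given by its
  symmetric, irreflexive edge relation.\<close>

definition network_edges :: "('x, 'a) csp \<Rightarrow> (('x \<Rightarrow> 'a) \<times> ('x \<Rightarrow> 'a)) set" where
  "network_edges F = {(\<sigma>, \<tau>). \<sigma> \<in> solutions F \<and> \<tau> \<in> solutions F \<and> \<sigma> \<noteq> \<tau> \<and>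
     (\<exists>x \<in> variables F. adjacent F x \<sigma> \<tau>)}"

definition network_connected :: "('x, 'a) csp \<Rightarrow> (('x \<Rightarrow> 'a) \<times> ('x \<Rightarrow> 'a)) set" where
  "network_connected F = {(\<sigma>, \<tau>). \<sigma> \<in> solutions F \<and> \<tau> \<in> solutions F \<and>
     (\<sigma>, \<tau>) \<in> (network_edges F)\<^sup>*}"

definition network_components :: "('x, 'a) csp \<Rightarrow> ('x \<Rightarrow> 'a) set set" where
  "network_components F = solutions F // network_connected F"

definition neighbours :: "('x, 'a) csp \<Rightarrow> ('x \<Rightarrow> 'a) \<Rightarrow> 'x \<Rightarrow> ('x \<Rightarrow> 'a) set" where
  "neighbours F \<sigma> x = {\<tau> \<in> solutions F. adjacent F x \<sigma> \<tau>}"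

definition allowed :: "('x, 'a) csp \<Rightarrow> ('x \<Rightarrow> 'a) \<Rightarrow> 'x \<Rightarrow> 'a set" where
  "allowed F \<sigma> x = (\<lambda>\<tau>. \<tau> x) ` neighbours F \<sigma> x"

definition weighting_seed :: "('x, 'a) csp \<Rightarrow> ('x \<Rightarrow> 'a \<Rightarrow> real) \<Rightarrow> bool" where
  "weighting_seed F s \<longleftrightarrow> (\<forall>x \<in> variables F. \<forall>a \<in> domain F. s x a \<ge> 0)"

definition unitary :: "('x, 'a) csp \<Rightarrow> ('x \<Rightarrow> 'a \<Rightarrow> real) \<Rightarrow> bool" where
  "unitary F s \<longleftrightarrow> (\<forall>x \<in> variables F. (\<Sum>a \<in> domain F. s x a) = 1)"

definition dispatcher :: "('x, 'a) csp \<Rightarrow> ('x \<Rightarrow> 'a \<Rightarrow> real) \<Rightarrow> bool" where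
  "dispatcher F d \<longleftrightarrow> (\<forall>x \<in> variables F. \<forall>a \<in> domain F. d x a > 0)"

definition omega ::
  "('x, 'a) csp \<Rightarrow> ('x \<Rightarrow> 'a \<Rightarrow> real) \<Rightarrow> ('x \<Rightarrow> 'a \<Rightarrow> real) \<Rightarrow> 'x \<Rightarrow> 'a \<Rightarrow> 'a set \<Rightarrow> real" where
  "omega F s d x a \<Delta> =
     (if a \<in> \<Delta> then s x a + d x a / (\<Sum>b \<in> \<Delta>. d x b) * (\<Sum>b \<in> domain F - \<Delta>. s x b) else 0)"

definition var_weight ::
  "('x, 'a) csp \<Rightarrow> ('x \<Rightarrow> 'a \<Rightarrow> real) \<Rightarrow> ('x \<Rightarrow> 'a \<Rightarrow> real) \<Rightarrow> ('x \<Rightarrow> 'a) \<Rightarrow> 'x \<Rightarrow> real" where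
  "var_weight F s d \<sigma> x = omega F s d x (\<sigma> x) (allowed F \<sigma> x)"

definition sol_weight ::
  "('x, 'a) csp \<Rightarrow> ('x \<Rightarrow> 'a \<Rightarrow> real) \<Rightarrow> ('x \<Rightarrow> 'a \<Rightarrow> real) \<Rightarrow> ('x \<Rightarrow> 'a) \<Rightarrow> real" where
  "sol_weight F s d \<sigma> = (\<Prod>x \<in> variables F. var_weight F s d \<sigma> x)"

definition set_weight ::
  "('x, 'a) csp \<Rightarrow> ('x \<Rightarrow> 'a \<Rightarrow> real) \<Rightarrow> ('x \<Rightarrow> 'a \<Rightarrow> real) \<Rightarrow> ('x \<Rightarrow> 'a) set \<Rightarrow> real" where
  "set_weight F s d g = (\<Sum>\<sigma> \<in> g. sol_weight F s d \<sigma>)"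

end

theory Submission
  imports Defs
begin

text \<open>The inequality \<open>W(g) \<ge> 1\<close> holds for every nonempty finite set \<open>g\<close> of valuations, once the
  values allowed at \<open>x\<close> are those \<open>a\<close> with \<open>\<sigma>(x := a) \<in> g\<close>; in a connected component these are the
  values allowed by the solutions network. One inducts on the variables. Partition \<open>g\<close> by the value
  \<open>a\<close> of a variable \<open>y\<close>, which does not change the values allowed at the other variables, and let
  \<open>B\<close> be the set of values taken by \<open>y\<close> on \<open>g\<close>. As \<open>\<omega>(y, a, \<Delta>)\<close> decreases in \<open>\<Delta>\<close>, replacing each
  allowed set at \<open>y\<close> by \<open>B\<close> can only decrease the weight, and then \<open>W(g)\<close> is at least a sum of the
  weights of the parts with coefficients \<open>\<omega>(y, a, B)\<close>, which add up to 1.\<close>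

lemma omega_nonneg:
  assumes "weighting_seed F s" "dispatcher F d" "x \<in> variables F" "\<Delta> \<subseteq> domain F"
  shows "omega F s d x a \<Delta> \<ge> 0"
proof -
  have "\<And>b. b \<in> domain F \<Longrightarrow> s x b \<ge> 0" "\<And>b. b \<in> domain F \<Longrightarrow> d x b \<ge> 0"
    using assms by (auto simp: weighting_seed_def dispatcher_def less_imp_le)
  then show ?thesis
    using assms(4) unfolding omega_def
    by (auto intro!: add_nonneg_nonneg mult_nonneg_nonneg divide_nonneg_nonneg sum_nonneg)
qed

text \<open>Enlarging the set increases the denominator in the share of \<open>a\<close> and leaves
  no more seed outside to dispatch, so neither factor of the added term grows.\<close>

lemma omega_antimono:
  assumes "finite (domain F)" "weighting_seed F s" "dispatcher F d" "x \<in> variables F"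
    and "a \<in> \<Delta>" "\<Delta> \<subseteq> B" "B \<subseteq> domain F"
  shows "omega F s d x a B \<le> omega F s d x a \<Delta>"
proof -
  have seed: "\<And>b. b \<in> domain F \<Longrightarrow> s x b \<ge> 0"
    using assms by (simp add: weighting_seed_def)
  have disp: "\<And>b. b \<in> domain F \<Longrightarrow> d x b > 0"
    using assms by (simp add: dispatcher_def)
  have fin: "finite B" "finite \<Delta>"
    using assms by (meson finite_subset)+
  have pos: "(\<Sum>b\<in>\<Delta>. d x b) > 0"
    using assms fin disp by (intro sum_pos) auto
  have "(\<Sum>b\<in>\<Delta>. d x b) \<le> (\<Sum>b\<in>B. d x b)"
    using assms fin disp by (intro sum_mono2) (auto intro: less_imp_le)
  then have coeff: "d x a / (\<Sum>b\<in>B. d x b) \<le> d x a / (\<Sum>b\<in>\<Delta>. d x b)"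
    using pos disp[of a] assms by (intro frac_le) auto
  have rest: "(\<Sum>b\<in>domain F - B. s x b) \<le> (\<Sum>b\<in>domain F - \<Delta>. s x b)"
    using assms seed by (intro sum_mono2) auto
  have "d x a / (\<Sum>b\<in>B. d x b) * (\<Sum>b\<in>domain F - B. s x b)
      \<le> d x a / (\<Sum>b\<in>\<Delta>. d x b) * (\<Sum>b\<in>domain F - \<Delta>. s x b)"
    using coeff rest pos disp[of a] assms seed
    by (intro mult_mono) (auto intro!: sum_nonneg divide_nonneg_pos)
  then show ?thesis
    using assms unfolding omega_def by auto
qed

text \<open>The shares given by \<open>d\<close> add up to 1 over \<open>B\<close>, so the seed
  lying outside \<open>B\<close> is handed over to \<open>B\<close> in full.\<close>

lemma sum_omega:
  assumes "finite (domain F)" "dispatcher F d" "unitary F s" "x \<in> variables F"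
    and "B \<noteq> {}" "B \<subseteq> domain F"
  shows "(\<Sum>a\<in>B. omega F s d x a B) = 1"
proof -
  have fin: "finite B"
    using assms by (meson finite_subset)
  have pos: "(\<Sum>b\<in>B. d x b) > 0"
    using assms fin by (intro sum_pos) (auto simp: dispatcher_def)
  have "(\<Sum>a\<in>B. omega F s d x a B)
      = (\<Sum>a\<in>B. s x a) + (\<Sum>a\<in>B. d x a) / (\<Sum>b\<in>B. d x b) * (\<Sum>b\<in>domain F - B. s x b)"
    by (simp add: omega_def sum.distrib flip: sum_distrib_right sum_divide_distrib)
  also have "\<dots> = (\<Sum>a\<in>domain F. s x a)"
    using pos assms sum.subset_diff[of B "domain F" "s x"] by simp
  finally show ?thesis
    using assms by (simp add: unitary_def)
qed

text \<open>Connectedness need not survive the splitting of \<open>g\<close> by the value of a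
  variable, so \<open>g\<close> is arbitrary here. Its members may also differ outside
  \<open>X\<close>.\<close>

lemma weight_of_finite_set_ge_1:
  assumes "finite (domain F)" "weighting_seed F s" "dispatcher F d" "unitary F s"
    and "finite X" "X \<subseteq> variables F"
    and "finite g" "g \<noteq> {}" "\<And>\<sigma> x. \<sigma> \<in> g \<Longrightarrow> x \<in> X \<Longrightarrow> \<sigma> x \<in> domain F"
  shows "(\<Sum>\<sigma>\<in>g. \<Prod>x\<in>X. omega F s d x (\<sigma> x) {a. \<sigma>(x := a) \<in> g}) \<ge> 1"
  using assms(5-)
proof (induction X arbitrary: g rule: finite_induct)
  case empty
  \<comment> \<open>Empty products are 1, so the sum is the cardinality of \<open>g\<close>.\<close>
  then show ?case
    by (simp add: Suc_leI card_gt_0_iff)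
next
  case (insert y X)
  let ?A = "\<lambda>\<sigma> x. {a. \<sigma>(x := a) \<in> g}"
  let ?P = "\<lambda>\<sigma>. \<Prod>x\<in>X. omega F s d x (\<sigma> x) (?A \<sigma> x)"
  define B where "B = (\<lambda>\<sigma>. \<sigma> y) ` g"
  have y: "y \<in> variables F"
    using insert.prems by simp
  have B: "B \<subseteq> domain F" "B \<noteq> {}"
    using insert.prems by (auto simp: B_def)
  have A_dom: "?A \<sigma> x \<subseteq> domain F" if "x \<in> insert y X" for \<sigma> x
    using that insert.prems(4) by (metis (mono_tags, lifting) fun_upd_same mem_Collect_eq subsetI)
  have A_B: "?A \<sigma> y \<subseteq> B" for \<sigma>
  proof
    fix a assume "a \<in> ?A \<sigma> y"
    then show "a \<in> B"
      unfolding B_def by (intro image_eqI[of _ _ "\<sigma>(y := a)"]) auto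
  qed
  have P_nonneg: "?P \<sigma> \<ge> 0" for \<sigma>
    using A_dom insert.prems(1) assms by (intro prod_nonneg omega_nonneg ballI) auto
  have part: "(\<Sum>\<sigma>\<in>{\<sigma> \<in> g. \<sigma> y = a}. ?P \<sigma>) \<ge> 1" if "a \<in> B" for a
  proof -
    let ?h = "{\<sigma> \<in> g. \<sigma> y = a}"
    have "(\<Sum>\<sigma>\<in>?h. \<Prod>x\<in>X. omega F s d x (\<sigma> x) {b. \<sigma>(x := b) \<in> ?h}) \<ge> 1"
      using insert.prems that by (intro insert.IH) (auto simp: B_def)
    \<comment> \<open>Since \<open>y\<close> is not in \<open>X\<close>, updating
      \<open>\<sigma>\<close> at a variable of \<open>X\<close> keeps its value at \<open>y\<close>,
      so the result lies in \<open>?h\<close> iff it lies in \<open>g\<close>.\<close>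
    also have "(\<Sum>\<sigma>\<in>?h. \<Prod>x\<in>X. omega F s d x (\<sigma> x) {b. \<sigma>(x := b) \<in> ?h}) = (\<Sum>\<sigma>\<in>?h. ?P \<sigma>)"
      using insert.hyps
      by (intro sum.cong prod.cong arg_cong[where f = "omega F s d _ _"]) auto
    finally show ?thesis .
  qed
  have "1 = (\<Sum>a\<in>B. omega F s d y a B)"
    using sum_omega[OF assms(1,3,4) y B(2,1)] by simp
  also have "\<dots> \<le> (\<Sum>a\<in>B. omega F s d y a B * (\<Sum>\<sigma>\<in>{\<sigma> \<in> g. \<sigma> y = a}. ?P \<sigma>))"
    using mult_left_mono[OF part omega_nonneg[OF assms(2,3) y B(1)]]
    by (intro sum_mono) simp
  also have "\<dots> = (\<Sum>a\<in>B. \<Sum>\<sigma>\<in>{\<sigma> \<in> g. \<sigma> y = a}. omega F s d y (\<sigma> y) B * ?P \<sigma>)"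
    by (simp add: sum_distrib_left)
  also have "\<dots> = (\<Sum>\<sigma>\<in>g. omega F s d y (\<sigma> y) B * ?P \<sigma>)"
    unfolding B_def by (rule sum.image_gen[symmetric]) (rule insert.prems)
  \<comment> \<open>The value \<open>\<sigma> y\<close> is itself allowed, because
    \<open>\<sigma>(y := \<sigma> y)\<close> is \<open>\<sigma>\<close>.\<close>
  also have "\<dots> \<le> (\<Sum>\<sigma>\<in>g. omega F s d y (\<sigma> y) (?A \<sigma> y) * ?P \<sigma>)"
    using A_B B(1)
    by (intro sum_mono mult_right_mono P_nonneg omega_antimono[OF assms(1-3) y]) auto
  also have "\<dots> = (\<Sum>\<sigma>\<in>g. \<Prod>x\<in>insert y X. omega F s d x (\<sigma> x) (?A \<sigma> x))"
    using insert.hyps by simp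
  finally show ?case .
qed

lemma network_component_subset:
  "g \<in> network_components F \<Longrightarrow> g \<subseteq> solutions F"
  by (auto simp: network_components_def network_connected_def elim!: quotientE)

lemma network_component_nonempty:
  "g \<in> network_components F \<Longrightarrow> g \<noteq> {}"
  by (auto simp: network_components_def network_connected_def elim!: quotientE)

lemma network_component_adjacent:
  assumes "g \<in> network_components F" "\<sigma> \<in> g" "x \<in> variables F"
    and "\<tau> \<in> solutions F" "adjacent F x \<sigma> \<tau>"
  shows "\<tau> \<in> g"
proof -
  obtain \<rho> where g: "g = network_connected F `` {\<rho>}"
    using assms(1) by (auto simp: network_components_def elim: quotientE)
  then have \<rho>: "\<rho> \<in> solutions F" "\<sigma> \<in> solutions F" "(\<rho>, \<sigma>) \<in> (network_edges F)\<^sup>*"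
    using assms(2) by (auto simp: network_connected_def)
  have "(\<sigma>, \<tau>) \<in> (network_edges F)\<^sup>*"
    \<comment> \<open>Edges join distinct solutions only, whereas adjacency is reflexive; equal
      solutions are joined by the empty path.\<close>
    using assms(3-5) \<rho>(2) by (cases "\<sigma> = \<tau>") (auto simp: network_edges_def)
  then show ?thesis
    using g \<rho> assms(4) by (auto simp: network_connected_def)
qed

text \<open>As valuations are extensional, a solution adjacent to \<open>\<sigma>\<close> at
  \<open>x\<close> is determined by its value there, and components are closed under
  adjacency.\<close>

lemma allowed_in_component:
  assumes "g \<in> network_components F" "\<sigma> \<in> g" "x \<in> variables F"
  shows "allowed F \<sigma> x = {a. \<sigma>(x := a) \<in> g}"
proof (intro set_eqI iffI)
  fix a assume "a \<in> allowed F \<sigma> x"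
  then obtain \<tau> where \<tau>: "\<tau> \<in> solutions F" "adjacent F x \<sigma> \<tau>" "a = \<tau> x"
    by (auto simp: allowed_def neighbours_def)
  have "\<sigma> \<in> extensional (variables F)" "\<tau> \<in> extensional (variables F)"
    using \<tau>(1) assms network_component_subset
    by (auto simp: solutions_def valuations_def PiE_def)
  then have "\<sigma>(x := a) = \<tau>"
    using \<tau>(2,3) by (intro extensionalityI[of _ "variables F"]) (auto simp: adjacent_def extensional_def assms)
  then show "a \<in> {a. \<sigma>(x := a) \<in> g}"
    using network_component_adjacent[OF assms \<tau>(1,2)] by simp
next
  fix a assume "a \<in> {a. \<sigma>(x := a) \<in> g}"
  then have "\<sigma>(x := a) \<in> neighbours F \<sigma> x"
    using network_component_subset[OF assms(1)] by (auto simp: neighbours_def adjacent_def)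
  then show "a \<in> allowed F \<sigma> x"
    unfolding allowed_def by (rule rev_image_eqI) simp
qed

theorem theorem12:
  fixes F :: "('x, 'a) csp"
    and s d :: "'x \<Rightarrow> 'a \<Rightarrow> real"
    and g :: "('x \<Rightarrow> 'a) set"
  assumes "csp_instance F"
    and "satisfiable F"
    and "g \<in> network_components F"
    and "weighting_seed F s"
    and "dispatcher F d"
    and "unitary F s"
  shows "set_weight F s d g \<ge> 1"
proof -
  have fin: "finite (variables F)" "finite (domain F)"
    using assms(1) by (auto simp: csp_instance_def)
  have sub: "g \<subseteq> variables F \<rightarrow>\<^sub>E domain F"
    using network_component_subset[OF assms(3)] by (auto simp: solutions_def valuations_def)
  have "1 \<le> (\<Sum>\<sigma>\<in>g. \<Prod>x\<in>variables F. omega F s d x (\<sigma> x) {a. \<sigma>(x := a) \<in> g})"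
  proof (rule weight_of_finite_set_ge_1)
    show "finite g"
      using sub fin by (meson finite_PiE finite_subset)
  qed (use assms fin sub network_component_nonempty in auto)
  also have "\<dots> = set_weight F s d g"
    by (simp add: set_weight_def sol_weight_def var_weight_def allowed_in_component[OF assms(3)])
  finally show ?thesis .
qed

end
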